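(* For each commutative semigroup $X$ the semigroup $\varphi^\bullet(X)$ of finitely supported filters on $X$ is supercommutative. Moreover, $\mathcal A*\mathcal B=\mathcal A\circledast\mathcal B$ for each finitely supported upfamily $\mathcal A\in\upsilon^\bullet(X)$ and each filter $\mathcal B\in\varphi(X)$.
   Context: An upfamily on a nonempty set $X$ is a nonempty family $\mathcal F$ of nonempty subsets of $X$ such that $F\in\mathcal F$ and $F\subset E\subset X$ imply $E\in\mathcal F$; $\upsilon(X)$ is the set of all upfamilies on $X$. A family $\mathcal G$ of nonempty subsets of $X$ generates the upfamily $\langle G:G\in\mathcal G\rangle=\{E\subset X:\exists G\in\mathcal G,\ G\subset E\}$. An upfamily is finitely supported if it equals $\langle F_1,\dots,F_n\rangle$ for some (finitely many, at least one) nonempty finite sets $F_1,\dots,F_n\subset X$; $\upsilon^\bullet(X)$ is the set of finitely supported upfamilies. A filter on $X$ is an upfamily closed under pairwise intersections; $\varphi(X)$ is the set of all filters, and $\varphi^\bullet(X)=\varphi(X)\cap\upsilon^\bullet(X)$. If $X$ is a semigroup, put for $\mathcal A,\mathcal B\in\upsilon(X)$: $\mathcal A*\mathcal B=\langle\bigcup_{a\in A}aB_a: A\in\mathcal A,\ (B_a)_{a\in A}\in\mathcal B^A\rangle$ and $\mathcal A\circledast\mathcal B=\langle AB:A\in\mathcal A,\ B\in\mathcal B\rangle$, where $AB=\{ab:a\in A,b\in B\}$. The operation $*$ is associative and $\varphi^\bullet(X)$ is a subsemigroup of $(\upsilon(X),* )$. A subsemigroup $S$ of $(\upsilon(X),*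 )$ is supercommutative if $\mathcal A*\mathcal B=\mathcal A\circledast\mathcal B=\mathcal B\circledast\mathcal A=\mathcal B*\mathcal A$ for all $\mathcal A,\mathcal B\in S$. *)

theory Defs
  imports "HOL-Library.FuncSet" "HOL-Library.Set_Algebras"
begin

text \<open>
  The underlying set \<open>X\<close> is the universe of a type, hence automatically nonempty; a commutative
  semigroup structure on it is an instance of the class \<^class>\<open>ab_semigroup_mult\<close>.
\<close>

definition upfamilies :: "'a set set set" where
  "upfamilies = {\<F>. \<F> \<noteq> {} \<and> {} \<notin> \<F> \<and> (\<forall>F\<in>\<F>. \<forall>E. F \<subseteq> E \<longrightarrow> E \<in> \<F>)}"

definition generated :: "'a set set \<Rightarrow> 'a set set" where
  "generated \<G> = {E. \<exists>G\<in>\<G>. G \<subseteq> E}"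

definition finitely_supported_upfamilies :: "'a set set set" where
  "finitely_supported_upfamilies =
    {generated \<G> | \<G>. finite \<G> \<and> \<G> \<noteq> {} \<and> (\<forall>F\<in>\<G>. F \<noteq> {} \<and> finite F)}"

definition filters :: "'a set set set" where
  "filters = {\<F> \<in> upfamilies. \<forall>A\<in>\<F>. \<forall>B\<in>\<F>. A \<inter> B \<in> \<F>}"

definition finitely_supported_filters :: "'a set set set" where
  "finitely_supported_filters = filters \<inter> finitely_supported_upfamilies"

text \<open>
  Below, \<open>a *o B = {a * b | b. b \<in> B}\<close> and, in the definition of \<open>\<circledast>\<close>, the product \<open>A * B\<close> of two
  sets is the elementwise one, both from \<^theory>\<open>HOL-Library.Set_Algebras\<close>.
\<close>

definition upfamily_mult :: "'a::semigroup_mult set set \<Rightarrow> 'a set set \<Rightarrow> 'a set set"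
    (infixl \<open>\<star>\<close> 70) where
  "\<A> \<star> \<B> = generated {\<Union>a\<in>A. a *o B a | A B. A \<in> \<A> \<and> B \<in> A \<rightarrow>\<^sub>E \<B>}"

definition upfamily_setmult :: "'a::semigroup_mult set set \<Rightarrow> 'a set set \<Rightarrow> 'a set set"
    (infixl \<open>\<circledast>\<close> 70) where
  "\<A> \<circledast> \<B> = generated {A * B | A B. A \<in> \<A> \<and> B \<in> \<B>}"

definition upfamily_subsemigroup :: "'a::semigroup_mult set set set \<Rightarrow> bool" where
  "upfamily_subsemigroup S \<longleftrightarrow> S \<subseteq> upfamilies \<and> (\<forall>\<A>\<in>S. \<forall>\<B>\<in>S. \<A> \<star> \<B> \<in> S)"

definition supercommutative :: "'a::semigroup_mult set set set \<Rightarrow> bool" where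
  "supercommutative S \<longleftrightarrow> upfamily_subsemigroup S \<and>
    (\<forall>\<A>\<in>S. \<forall>\<B>\<in>S. \<A> \<star> \<B> = \<A> \<circledast> \<B> \<and> \<A> \<circledast> \<B> = \<B> \<circledast> \<A> \<and> \<B> \<circledast> \<A> = \<B> \<star> \<A>)"

end

theory Submission
  imports Defs
begin

text \<open>
  If \<open>E\<close> contains \<open>\<Union>a\<in>A. a *o B a\<close> and \<open>G \<subseteq> A\<close> is a finite member of \<open>\<A>\<close>, then \<open>\<Inter>a\<in>G. B a\<close> is a
  member of the filter \<open>\<B>\<close> whose product with \<open>G\<close> lies in \<open>E\<close>; this gives \<open>\<A> \<star> \<B> = \<A> \<circledast> \<B>\<close>.
  A finitely supported filter is generated by a single finite set (the intersection of its finitely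
  many generators), so on such filters \<open>\<circledast>\<close> is the product of finite sets.
\<close>

lemma generated_in_upfamilies:
  assumes "\<G> \<noteq> {}" "{} \<notin> \<G>"
  shows "generated \<G> \<in> upfamilies"
  using assms unfolding upfamilies_def generated_def by auto

lemma finitely_supported_upfamilies_subset: "finitely_supported_upfamilies \<subseteq> upfamilies"
  unfolding finitely_supported_upfamilies_def by (auto intro: generated_in_upfamilies)

text \<open>Any generator contained in \<open>A\<close> serves as \<open>G\<close>. It supplies the
  finite index set that makes an intersection of members of a filter finite.\<close>

lemma finitely_supported_upfamily_finite_subset:
  assumes "\<A> \<in> finitely_supported_upfamilies" "A \<in> \<A>"
  obtains G where "G \<in> \<A>" "finite G" "G \<subseteq> A"
  using assms unfolding finitely_supported_upfamilies_def generated_def by blast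

lemma filter_Inter:
  assumes "\<F> \<in> filters" "finite \<G>" "\<G> \<noteq> {}" "\<G> \<subseteq> \<F>"
  shows "\<Inter>\<G> \<in> \<F>"
  using assms(2-4)
proof (induction \<G> rule: finite_ne_induct)
  case (insert G \<G>)
  then show ?case using assms(1) unfolding filters_def by simp
qed simp

text \<open>A product \<open>A * B\<close> is the union of the translates \<open>a *o B\<close>, the
  case of a constant family.\<close>

lemma upfamily_setmult_subset_mult: "\<A> \<circledast> \<B> \<subseteq> \<A> \<star> \<B>"
proof
  fix E assume "E \<in> \<A> \<circledast> \<B>"
  then obtain A B where AB: "A \<in> \<A>" "B \<in> \<B>" "A * B \<subseteq> E"
    unfolding upfamily_setmult_def generated_def by blast
  \<comment> \<open>Members of \<open>PiE\<close> are undefined outside \<open>A\<close>, hence the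
    \<open>restrict\<close>.\<close>
  let ?f = "restrict (\<lambda>_. B) A"
  have "(\<Union>a\<in>A. a *o ?f a) \<subseteq> E"
    using AB(3) unfolding elt_set_times_def set_times_def by auto
  moreover have "?f \<in> A \<rightarrow>\<^sub>E \<B>" using AB(2) by auto
  ultimately show "E \<in> \<A> \<star> \<B>"
    using AB(1) unfolding upfamily_mult_def generated_def by blast
qed

lemma upfamily_mult_eq_setmult:
  assumes A: "\<A> \<in> finitely_supported_upfamilies" and B: "\<B> \<in> filters"
  shows "\<A> \<star> \<B> = \<A> \<circledast> \<B>"
proof
  show "\<A> \<star> \<B> \<subseteq> \<A> \<circledast> \<B>"
  proof
    fix E assume "E \<in> \<A> \<star> \<B>"
    then obtain A f where f: "A \<in> \<A>" "f \<in> A \<rightarrow>\<^sub>E \<B>" "(\<Union>a\<in>A. a *o f a) \<subseteq> E"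
      unfolding upfamily_mult_def generated_def by blast
    obtain G where G: "G \<in> \<A>" "finite G" "G \<subseteq> A"
      using finitely_supported_upfamily_finite_subset[OF A f(1)] .
    have "G \<noteq> {}"
      using A G(1) finitely_supported_upfamilies_subset unfolding upfamilies_def by blast
    then have "(\<Inter>a\<in>G. f a) \<in> \<B>" using filter_Inter[OF B, of "f ` G"] G f(2) by auto
    moreover have "G * (\<Inter>a\<in>G. f a) \<subseteq> E"
      using f(3) G(3) unfolding elt_set_times_def set_times_def by fast
    ultimately show "E \<in> \<A> \<circledast> \<B>"
      using G(1) unfolding upfamily_setmult_def generated_def by blast
  qed
qed (rule upfamily_setmult_subset_mult)

text \<open>The intersection of the generators belongs to the filter, so it is nonempty; it is
  finite and lies below every generator. Conversely, the supersets of a fixed set are closed under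
  intersection.\<close>

lemma finitely_supported_filters_eq:
  "finitely_supported_filters = {generated {F} | F. F \<noteq> {} \<and> finite F}"
proof (intro subset_antisym subsetI)
  fix \<F> :: "'a set set" assume F: "\<F> \<in> finitely_supported_filters"
  then obtain \<G> where G: "\<F> = generated \<G>" "finite \<G>" "\<G> \<noteq> {}" "\<forall>F\<in>\<G>. F \<noteq> {} \<and> finite F"
    unfolding finitely_supported_filters_def finitely_supported_upfamilies_def by blast
  have fil: "\<F> \<in> filters" using F unfolding finitely_supported_filters_def by blast
  have "\<Inter>\<G> \<in> \<F>"
    using G(1) by (intro filter_Inter[OF fil G(2,3)]) (auto simp: generated_def)
  moreover from this have "\<Inter>\<G> \<noteq> {}" using fil unfolding filters_def upfamilies_def by auto
  moreover have "finite (\<Inter>\<G>)" using G(3,4) by (meson Inter_lower ex_in_conv finite_subset)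
  moreover have "\<F> = generated {\<Inter>\<G>}"
  proof
    show "\<F> \<subseteq> generated {\<Inter>\<G>}" unfolding G(1) generated_def by blast
    show "generated {\<Inter>\<G>} \<subseteq> \<F>"
      using \<open>\<Inter>\<G> \<in> \<F>\<close> fil unfolding filters_def upfamilies_def generated_def by blast
  qed
  ultimately show "\<F> \<in> {generated {F} | F. F \<noteq> {} \<and> finite F}" by blast
next
  fix \<F> :: "'a set set" assume "\<F> \<in> {generated {F} | F. F \<noteq> {} \<and> finite F}"
  then obtain F where F: "\<F> = generated {F}" "F \<noteq> {}" "finite F" by blast
  have "\<F> \<in> upfamilies" using F generated_in_upfamilies[of "{F}"] by auto
  then have "\<F> \<in> filters" using F unfolding filters_def generated_def by auto
  moreover have "\<F> \<in> finitely_supported_upfamilies"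
    using F unfolding finitely_supported_upfamilies_def by blast
  ultimately show "\<F> \<in> finitely_supported_filters"
    unfolding finitely_supported_filters_def by blast
qed

text \<open>\<open>F\<close> and \<open>G\<close> are the least members of the two factors, and the
  product of sets is monotone.\<close>

lemma upfamily_setmult_generated_singleton:
  "generated {F} \<circledast> generated {G} = generated {F * G}"
proof
  show "generated {F} \<circledast> generated {G} \<subseteq> generated {F * G}"
    unfolding upfamily_setmult_def generated_def by (auto dest: set_times_mono2[of F _ G])
  have "F \<in> generated {F}" "G \<in> generated {G}" unfolding generated_def by auto
  then show "generated {F * G} \<subseteq> generated {F} \<circledast> generated {G}"
    unfolding upfamily_setmult_def generated_def by fastforce
qed

lemma upfamily_setmult_in_finitely_supported_filters:
  assumes "\<A> \<in> finitely_supported_filters" "\<B> \<in> finitely_supported_filters"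
  shows "\<A> \<circledast> \<B> \<in> finitely_supported_filters"
proof -
  obtain F G where FG: "\<A> = generated {F}" "F \<noteq> {}" "finite F" "\<B> = generated {G}" "G \<noteq> {}" "finite G"
    using assms unfolding finitely_supported_filters_eq by blast
  then have "F * G \<noteq> {}" "finite (F * G)"
    by (auto simp: set_times_def finite_set_times)
  then show ?thesis
    unfolding finitely_supported_filters_eq FG(1,4) upfamily_setmult_generated_singleton by blast
qed

lemma upfamily_setmult_commute:
  fixes \<A> \<B> :: "'a::ab_semigroup_mult set set"
  shows "\<A> \<circledast> \<B> = \<B> \<circledast> \<A>"
proof -
  have "{A * B | A B. A \<in> \<A> \<and> B \<in> \<B>} = {B * A | B A. B \<in> \<B> \<and> A \<in> \<A>}"
    \<comment> \<open>\<open>mult.commute\<close> is applied to sets, which inherit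
      \<open>ab_semigroup_mult\<close> from their elements.\<close>
    by (metis (no_types, opaque_lifting) mult.commute)
  then show ?thesis unfolding upfamily_setmult_def by simp
qed

theorem proposition6p4:
  shows "supercommutative (finitely_supported_filters :: 'a::ab_semigroup_mult set set set)
    \<and> (\<forall>\<A> \<in> (finitely_supported_upfamilies :: 'a set set set). \<forall>\<B> \<in> filters. \<A> \<star> \<B> = \<A> \<circledast> \<B>)"
proof -
  let ?S = "finitely_supported_filters :: 'a set set set"
  have eq: "\<A> \<star> \<B> = \<A> \<circledast> \<B>" if "\<A> \<in> ?S" "\<B> \<in> ?S" for \<A> \<B>
    using that upfamily_mult_eq_setmult unfolding finitely_supported_filters_def by blast
  have "?S \<subseteq> upfamilies" unfolding finitely_supported_filters_def filters_def by blast
  \<comment> \<open>Closure under \<open>\<star>\<close> is closure under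
    \<open>\<circledast>\<close>, since \<open>eq\<close> identifies the two operations on
    \<open>?S\<close>.\<close>
  then have "upfamily_subsemigroup ?S"
    unfolding upfamily_subsemigroup_def
    using eq upfamily_setmult_in_finitely_supported_filters by metis
  then have "supercommutative ?S"
    unfolding supercommutative_def using eq upfamily_setmult_commute by metis
  then show ?thesis using upfamily_mult_eq_setmult by blast
qed

end
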